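(* Let $A\in\mathbb{R}^{n\times n}$ and $B\in\mathbb{R}^{n\times m}$, let $\mathcal{S}\subset\mathbb{R}^{m\times n}$ be a linear subspace, let $\{S_1,S_2,\dots,S_k\}$ be a basis of $\mathcal{S}$, and let $$L := [\,S_1\,|\,S_2\,|\,\cdots\,|\,S_k\,]\in\mathbb{R}^{m\times nk}.$$ Define the structure set $$\Upsilon := \{Q\in\mathbb{R}^{n\times n} : \exists\, \Lambda\in\mathbb{R}^{k\times k}\ \text{nonsingular such that}\ L(I_k\otimes Q)=L(\Lambda\otimes I_n)\}.$$ Assume that there exist a symmetric positive definite matrix $P\in\mathbb{R}^{n\times n}$, a matrix $R\in\operatorname{span}\{S_1,S_2,\dots,S_k\}$, and a nonsingular matrix $X\in\mathbb{R}^{n\times n}$ such that $X\in\Upsilon$ and $$\begin{bmatrix}0&P\\ P&0\end{bmatrix}+\operatorname{He}\left(\begin{bmatrix}AX+BR& AX+BR\\ -X&-X\end{bmatrix}\right)\prec 0.$$ Then $K=RX^{-1}$ satisfies $K\in\mathcal{S}$ and $A+BK$ is Hurwitz.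
   Context: For a real square matrix $Z$, $\operatorname{He}(Z)=Z+Z^{\top}$. For a symmetric matrix $M$, $M\prec 0$ means $M$ is negative definite. $\otimes$ denotes the Kronecker product and $I_d$ the $d\times d$ identity matrix. $[\,S_1\,|\cdots|\,S_k\,]$ denotes horizontal concatenation of the matrices. A real square matrix is Hurwitz if all its eigenvalues have strictly negative real part. *)

theory Defs
  imports
    "Jordan_Normal_Form.Char_Poly"
    "Jordan_Normal_Form.VS_Connect"
    "Jordan_Normal_Form.Gauss_Jordan_Elimination"
begin

definition He :: "real mat \<Rightarrow> real mat" where
  "He Z = Z + Z\<^sup>T"

definition pos_definite :: "real mat \<Rightarrow> bool" where
  "pos_definite M \<longleftrightarrow> square_mat M \<and> M\<^sup>T = M \<and>
     (\<forall>v \<in> carrier_vec (dim_row M). v \<noteq> 0\<^sub>v (dim_row M) \<longrightarrow> v \<bullet> (M *\<^sub>v v) > 0)"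

definition neg_definite :: "real mat \<Rightarrow> bool" where
  "neg_definite M \<longleftrightarrow> square_mat M \<and> M\<^sup>T = M \<and>
     (\<forall>v \<in> carrier_vec (dim_row M). v \<noteq> 0\<^sub>v (dim_row M) \<longrightarrow> v \<bullet> (M *\<^sub>v v) < 0)"

text \<open>Eigenvalues of a real matrix are taken in the complex numbers.\<close>

definition hurwitz :: "real mat \<Rightarrow> bool" where
  "hurwitz M \<longleftrightarrow> square_mat M \<and>
     (\<forall>z. eigenvalue (map_mat complex_of_real M) z \<longrightarrow> Re z < 0)"

definition kronecker :: "real mat \<Rightarrow> real mat \<Rightarrow> real mat" where
  "kronecker M N = mat (dim_row M * dim_row N) (dim_col M * dim_col N)
     (\<lambda>(i, j). M $$ (i div dim_row N, j div dim_col N) * N $$ (i mod dim_row N, j mod dim_col N))"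

text \<open>Horizontal concatenation. The number of rows is a parameter because it cannot be read
  off an empty list of blocks.\<close>

definition hconcat :: "nat \<Rightarrow> real mat list \<Rightarrow> real mat" where
  "hconcat m Ss = mat_of_cols m (concat (map cols Ss))"

definition structure_set :: "nat \<Rightarrow> nat \<Rightarrow> real mat list \<Rightarrow> real mat set" where
  "structure_set m n Ss =
     (let k = length Ss; L = hconcat m Ss in
      {Q \<in> carrier_mat n n. \<exists>\<Lambda> \<in> carrier_mat k k. invertible_mat \<Lambda> \<and>
         L * kronecker (1\<^sub>m k) Q = L * kronecker \<Lambda> (1\<^sub>m n)})"

end

theory Submission
  imports Defs
begin

text \<open>
  Write \<open>M = A + B * K\<close>, so that \<open>A * X + B * R = M * X\<close>. The two conclusions are independent.

  \<^emph>\<open>Stability.\<close> Multiplying the matrix inequality by the row block \<open>[I, M]\<close> on the left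
  and by its transpose on the right annihilates the term that contains \<open>X\<close>, because
  \<open>[I, M]\<close> times the block column \<open>(M * X, - X)\<close> is \<open>M * X - M * X = 0\<close>. What survives is the
  Lyapunov inequality \<open>M * P + P * M\<^sup>T < 0\<close> (\<open>lmi_lyapunov\<close>). As \<open>P\<close> is positive definite,
  \<open>M\<^sup>T\<close> is Hurwitz (\<open>lyapunov_hurwitz\<close>), and \<open>M\<close> has the same eigenvalues.

  \<^emph>\<open>Structure.\<close> Read blockwise, \<open>L(I \<otimes> X) = L(\<Lambda> \<otimes> I)\<close> says that each \<open>S\<^sub>j * X\<close> is the
  combination of the \<open>S\<^sub>i\<close> whose coefficients form column \<open>j\<close> of \<open>\<Lambda>\<close> (\<open>structure_set_block\<close>):
  right multiplication by \<open>X\<close> acts on the span of the \<open>S\<^sub>i\<close> through \<open>\<Lambda>\<close>. Since \<open>\<Lambda>\<close> is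
  invertible, right multiplication by the inverse of \<open>X\<close> acts through the inverse of \<open>\<Lambda>\<close>
  and in particular keeps the span invariant (\<open>structure_set_inverse_comb\<close>). Hence
  \<open>K\<close>, the product of \<open>R\<close> with the inverse of \<open>X\<close>, stays in the subspace.
\<close>

section \<open>Inverses and linear combinations of matrices\<close>

lemma mat_inverse_of_invertible:
  fixes X :: "'a :: field mat"
  assumes X: "X \<in> carrier_mat n n" and inv: "invertible_mat X"
  obtains Y where "mat_inverse X = Some Y" "Y \<in> carrier_mat n n"
    "X * Y = 1\<^sub>m n" "Y * X = 1\<^sub>m n"
proof -
  obtain Z where XZ: "X * Z = 1\<^sub>m n" and ZX: "Z * X = 1\<^sub>m (dim_row Z)"
    using inv X unfolding invertible_mat_def inverts_mat_def by auto
  have "dim_col Z = n" using arg_cong[OF XZ, of dim_col] by simp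
  moreover have "dim_row Z = n" using arg_cong[OF ZX, of dim_col] X by simp
  ultimately have "X \<in> Units (ring_mat TYPE('a) n ())"
    using X XZ ZX unfolding Units_def ring_mat_def by auto
  then obtain Y where "mat_inverse X = Some Y"
    using mat_inverse(1)[OF X, of "()"] by (cases "mat_inverse X") auto
  with mat_inverse(2)[OF X this] show ?thesis using that by blast
qed

text \<open>Coefficients are indexed by positions in the list rather than by the matrices, since in the
  structure equation they are the entries of a matrix column.\<close>

definition mat_list_comb :: "nat \<Rightarrow> nat \<Rightarrow> (nat \<Rightarrow> real) \<Rightarrow> real mat list \<Rightarrow> real mat" where
  "mat_list_comb m n c Ss = mat m n (\<lambda>(p, q). \<Sum>i<length Ss. c i * Ss ! i $$ (p, q))"

lemma mat_list_comb_carrier [simp]: "mat_list_comb m n c Ss \<in> carrier_mat m n"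
  by (simp add: mat_list_comb_def)

lemma mat_list_comb_mem_submodule:
  assumes W: "submodule class_ring W (module_mat TYPE(real) m n)"
    and "set Ss \<subseteq> W"
  shows "mat_list_comb m n c Ss \<in> W"
  using assms(2)
proof (induction Ss rule: rev_induct)
  case Nil
  have "mat_list_comb m n c [] = 0\<^sub>m m n"
    by (auto simp: mat_list_comb_def)
  then show ?case using submodule.zero_closed[OF W] by (simp add: module_mat_simps)
next
  case (snoc S Ss)
  have "S \<in> carrier_mat m n"
    using submodule.subset[OF W] snoc.prems by (auto simp: module_mat_simps)
  then have "mat_list_comb m n c (Ss @ [S]) = mat_list_comb m n c Ss + c (length Ss) \<cdot>\<^sub>m S"
    by (intro eq_matI) (auto simp: mat_list_comb_def nth_append)
  moreover have "mat_list_comb m n c Ss \<in> W" "c (length Ss) \<cdot>\<^sub>m S \<in> W"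
    using snoc submodule.smult_closed[OF W, of "c (length Ss)" S]
    by (auto simp: module_mat_simps)
  ultimately show ?case
    using submodule.m_closed[OF W] by (simp add: module_mat_simps)
qed

lemma mat_list_comb_mult:
  assumes "set Ss \<subseteq> carrier_mat m n" and X: "X \<in> carrier_mat n l"
  shows "mat_list_comb m n c Ss * X = mat_list_comb m l c (map (\<lambda>S. S * X) Ss)"
proof (rule eq_matI)
  fix p q
  assume "p < dim_row (mat_list_comb m l c (map (\<lambda>S. S * X) Ss))"
    and "q < dim_col (mat_list_comb m l c (map (\<lambda>S. S * X) Ss))"
  then have pq: "p < m" "q < l" by (simp_all add: mat_list_comb_def)
  have S: "Ss ! i \<in> carrier_mat m n" if "i < length Ss" for i
    using assms(1) nth_mem[OF that] by blast
  have "(mat_list_comb m n c Ss * X) $$ (p, q)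
      = (\<Sum>r<n. (\<Sum>i<length Ss. c i * Ss ! i $$ (p, r)) * X $$ (r, q))"
    using pq X by (simp add: mat_list_comb_def scalar_prod_def lessThan_atLeast0)
  also have "\<dots> = (\<Sum>i<length Ss. c i * (\<Sum>r<n. Ss ! i $$ (p, r) * X $$ (r, q)))"
    by (simp add: sum_distrib_left sum_distrib_right mult.assoc) (rule sum.swap)
  also have "\<dots> = (\<Sum>i<length Ss. c i * (Ss ! i * X) $$ (p, q))"
  proof (rule sum.cong[OF refl])
    fix i assume "i \<in> {..<length Ss}"
    then have "Ss ! i \<in> carrier_mat m n" using S by simp
    then show "c i * (\<Sum>r<n. Ss ! i $$ (p, r) * X $$ (r, q)) = c i * (Ss ! i * X) $$ (p, q)"
      using pq X by (simp add: scalar_prod_def lessThan_atLeast0)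
  qed
  finally show "(mat_list_comb m n c Ss * X) $$ (p, q)
      = mat_list_comb m l c (map (\<lambda>S. S * X) Ss) $$ (p, q)"
    using pq by (simp add: mat_list_comb_def)
qed (use X in \<open>simp_all add: mat_list_comb_def\<close>)

section \<open>The structure equation read blockwise\<close>

lemma block_index_less:
  fixes j q k n :: nat
  assumes "j < k" "q < n"
  shows "j * n + q < k * n"
proof -
  have "j * n + q < Suc j * n" using assms by simp
  also have "\<dots> \<le> k * n" using assms by (intro mult_le_mono1) simp
  finally show ?thesis .
qed

lemma kronecker_block_index:
  assumes "M \<in> carrier_mat a b" "N \<in> carrier_mat c d"
    and "i < a" "j < b" "r < c" "q < d"
  shows "kronecker M N $$ (i * c + r, j * d + q) = M $$ (i, j) * N $$ (r, q)"
  using assms block_index_less[of i a r c] block_index_less[of j b q d]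
  by (simp add: kronecker_def)

lemma concat_uniform_nth:
  assumes "\<And>xs. xs \<in> set xss \<Longrightarrow> length xs = n" and "j < length xss" and "q < n"
  shows "concat xss ! (j * n + q) = xss ! j ! q"
  using assms
proof (induction xss arbitrary: j)
  case (Cons xs xss)
  then show ?case by (cases j) (auto simp: nth_append)
qed simp

lemma length_concat_cols:
  assumes "set Ss \<subseteq> carrier_mat m n"
  shows "length (concat (map cols Ss)) = length Ss * n"
  using assms by (induction Ss) auto

lemma hconcat_carrier:
  assumes "set Ss \<subseteq> carrier_mat m n"
  shows "hconcat m Ss \<in> carrier_mat m (length Ss * n)"
  unfolding hconcat_def length_concat_cols[OF assms, symmetric] by (rule mat_of_cols_carrier)

lemma hconcat_block_index:
  assumes Ss: "set Ss \<subseteq> carrier_mat m n" and "p < m" "j < length Ss" "q < n"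
  shows "hconcat m Ss $$ (p, j * n + q) = Ss ! j $$ (p, q)"
proof -
  have S: "Ss ! j \<in> carrier_mat m n" using Ss nth_mem[OF assms(3)] by blast
  have "concat (map cols Ss) ! (j * n + q) = map cols Ss ! j ! q"
    using assms by (intro concat_uniform_nth) auto
  then show ?thesis
    using assms S block_index_less[OF assms(3,4)]
    by (simp add: hconcat_def mat_of_cols_index cols_nth length_concat_cols[OF Ss] del: length_concat)
qed

text \<open>The rows of the Kronecker factor fall into one group of \<open>n\<close> for each block of the
  concatenation, so that the sum defining an entry of the product splits into these groups, and
  the group of block \<open>i\<close> sums to a multiple of an entry of \<open>Ss ! i * N\<close>. Both sides of the
  structure equation are instances: one with \<open>\<Lambda>\<close> the identity, the other with \<open>N\<close> the
  identity.\<close>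

lemma hconcat_mult_kronecker_block_index:
  assumes Ss: "set Ss \<subseteq> carrier_mat m n"
    and \<Lambda>: "\<Lambda> \<in> carrier_mat (length Ss) k" and N: "N \<in> carrier_mat n l"
    and "p < m" "j < k" "q < l"
  shows "(hconcat m Ss * kronecker \<Lambda> N) $$ (p, j * l + q)
    = mat_list_comb m l (\<lambda>i. \<Lambda> $$ (i, j)) (map (\<lambda>S. S * N) Ss) $$ (p, q)"
proof -
  let ?L = "hconcat m Ss" and ?K = "kronecker \<Lambda> N" and ?t = "length Ss"
  have K: "?K \<in> carrier_mat (?t * n) (k * l)" using \<Lambda> N by (simp add: kronecker_def)
  have L: "?L \<in> carrier_mat m (?t * n)" by (rule hconcat_carrier[OF Ss])
  have jq: "j * l + q < k * l" using assms(5,6) by (rule block_index_less)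
  let ?f = "\<lambda>s. ?L $$ (p, s) * ?K $$ (s, j * l + q)"
  have "(?L * ?K) $$ (p, j * l + q) = sum ?f {..<?t * n}"
    using L K jq \<open>p < m\<close> by (simp add: scalar_prod_def lessThan_atLeast0)
  also have "\<dots> = (\<Sum>i<?t. sum ?f {i * n..<i * n + n})"
    by (rule sum.nat_group[symmetric])
  also have "\<dots> = (\<Sum>i<?t. \<Lambda> $$ (i, j) * (Ss ! i * N) $$ (p, q))"
  proof (rule sum.cong[OF refl])
    fix i assume "i \<in> {..<?t}"
    then have i: "i < ?t" by simp
    have S: "Ss ! i \<in> carrier_mat m n" using Ss nth_mem[OF i] by blast
    have "sum ?f {i * n..<i * n + n} = (\<Sum>r<n. ?f (i * n + r))"
      using sum.shift_bounds_nat_ivl[of ?f 0 "i * n" n] by (simp add: add.commute lessThan_atLeast0)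
    also have "\<dots> = (\<Sum>r<n. Ss ! i $$ (p, r) * (\<Lambda> $$ (i, j) * N $$ (r, q)))"
      using assms i
      by (intro sum.cong[OF refl])
        (simp add: hconcat_block_index[OF Ss] kronecker_block_index[OF \<Lambda> N])
    also have "\<dots> = \<Lambda> $$ (i, j) * (\<Sum>r<n. Ss ! i $$ (p, r) * N $$ (r, q))"
      by (simp add: sum_distrib_left mult.left_commute)
    also have "\<dots> = \<Lambda> $$ (i, j) * (Ss ! i * N) $$ (p, q)"
      using S N assms by (simp add: scalar_prod_def lessThan_atLeast0)
    finally show "sum ?f {i * n..<i * n + n} = \<Lambda> $$ (i, j) * (Ss ! i * N) $$ (p, q)" .
  qed
  finally show ?thesis using assms by (simp add: mat_list_comb_def)
qed

lemma structure_set_block: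
  assumes Ss: "set Ss \<subseteq> carrier_mat m n" and X: "X \<in> carrier_mat n n"
    and \<Lambda>: "\<Lambda> \<in> carrier_mat (length Ss) (length Ss)"
    and eq: "hconcat m Ss * kronecker (1\<^sub>m (length Ss)) X = hconcat m Ss * kronecker \<Lambda> (1\<^sub>m n)"
    and j: "j < length Ss"
  shows "Ss ! j * X = mat_list_comb m n (\<lambda>i. \<Lambda> $$ (i, j)) Ss"
proof (rule eq_matI)
  have S: "Ss ! i \<in> carrier_mat m n" if "i < length Ss" for i
    using Ss nth_mem[OF that] by blast
  fix p q
  assume "p < dim_row (mat_list_comb m n (\<lambda>i. \<Lambda> $$ (i, j)) Ss)"
    and "q < dim_col (mat_list_comb m n (\<lambda>i. \<Lambda> $$ (i, j)) Ss)"
  then have pq: "p < m" "q < n" by (simp_all add: mat_list_comb_def)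
  have "(Ss ! j * X) $$ (p, q)
      = (\<Sum>i<length Ss. if i = j then (Ss ! i * X) $$ (p, q) else 0)"
    using j by simp
  also have "\<dots> = (\<Sum>i<length Ss. 1\<^sub>m (length Ss) $$ (i, j) * (Ss ! i * X) $$ (p, q))"
    using j by (intro sum.cong[OF refl]) auto
  also have "\<dots> = mat_list_comb m n (\<lambda>i. 1\<^sub>m (length Ss) $$ (i, j)) (map (\<lambda>S. S * X) Ss) $$ (p, q)"
    using pq by (simp add: mat_list_comb_def del: index_one_mat)
  also have "\<dots> = (hconcat m Ss * kronecker (1\<^sub>m (length Ss)) X) $$ (p, j * n + q)"
    by (rule hconcat_mult_kronecker_block_index[OF Ss _ X pq(1) j pq(2), symmetric]) simp
  also have "\<dots> = mat_list_comb m n (\<lambda>i. \<Lambda> $$ (i, j)) (map (\<lambda>S. S * 1\<^sub>m n) Ss) $$ (p, q)"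
    unfolding eq by (rule hconcat_mult_kronecker_block_index[OF Ss \<Lambda> _ pq(1) j pq(2)]) simp
  also have "map (\<lambda>S. S * 1\<^sub>m n) Ss = Ss"
    using Ss by (intro map_idI) auto
  finally show "(Ss ! j * X) $$ (p, q) = mat_list_comb m n (\<lambda>i. \<Lambda> $$ (i, j)) Ss $$ (p, q)" .
next
  show "dim_row (Ss ! j * X) = dim_row (mat_list_comb m n (\<lambda>i. \<Lambda> $$ (i, j)) Ss)"
    using Ss nth_mem[OF j] by (auto simp: mat_list_comb_def)
qed (use X in \<open>simp add: mat_list_comb_def\<close>)

text \<open>Combining the matrices \<open>Ss ! i * X\<close> with column \<open>j\<close> of the inverse of \<open>\<Lambda>\<close> recovers
  \<open>Ss ! j\<close>. So \<open>Ss ! j\<close> is a combination of the list times \<open>X\<close>, and \<open>Y\<close> cancels \<open>X\<close>.\<close>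

lemma structure_set_inverse_comb:
  assumes Ss: "set Ss \<subseteq> carrier_mat m n" and XU: "X \<in> structure_set m n Ss"
    and Y: "Y \<in> carrier_mat n n" and XY: "X * Y = 1\<^sub>m n" and j: "j < length Ss"
  shows "\<exists>c. Ss ! j * Y = mat_list_comb m n c Ss"
proof -
  let ?k = "length Ss"
  have S: "Ss ! i \<in> carrier_mat m n" if "i < ?k" for i
    using Ss nth_mem[OF that] by blast
  obtain \<Lambda> where X: "X \<in> carrier_mat n n" and \<Lambda>: "\<Lambda> \<in> carrier_mat ?k ?k"
    and inv: "invertible_mat \<Lambda>"
    and eq: "hconcat m Ss * kronecker (1\<^sub>m ?k) X = hconcat m Ss * kronecker \<Lambda> (1\<^sub>m n)"
    using XU unfolding structure_set_def Let_def by blast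
  obtain \<Gamma> where \<Gamma>: "\<Gamma> \<in> carrier_mat ?k ?k" and \<Lambda>\<Gamma>: "\<Lambda> * \<Gamma> = 1\<^sub>m ?k"
    using mat_inverse_of_invertible[OF \<Lambda> inv] by blast
  let ?c = "\<lambda>i. \<Gamma> $$ (i, j)"
  have "mat_list_comb m n ?c Ss * X = mat_list_comb m n ?c (map (\<lambda>S. S * X) Ss)"
    by (rule mat_list_comb_mult[OF Ss X])
  also have "\<dots> = Ss ! j"
  proof (rule eq_matI)
    fix p q
    assume "p < dim_row (Ss ! j)" "q < dim_col (Ss ! j)"
    then have pq: "p < m" "q < n" using S[OF j] by auto
    have "mat_list_comb m n ?c (map (\<lambda>S. S * X) Ss) $$ (p, q)
        = (\<Sum>i<?k. \<Gamma> $$ (i, j) * (\<Sum>l<?k. \<Lambda> $$ (l, i) * Ss ! l $$ (p, q)))"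
      using pq by (simp add: mat_list_comb_def structure_set_block[OF Ss X \<Lambda> eq])
    also have "\<dots> = (\<Sum>l<?k. \<Sum>i<?k. \<Gamma> $$ (i, j) * (\<Lambda> $$ (l, i) * Ss ! l $$ (p, q)))"
      unfolding sum_distrib_left by (rule sum.swap)
    also have "\<dots> = (\<Sum>l<?k. (\<Sum>i<?k. \<Lambda> $$ (l, i) * \<Gamma> $$ (i, j)) * Ss ! l $$ (p, q))"
      by (simp add: sum_distrib_left mult_ac)
    also have "\<dots> = (\<Sum>l<?k. (\<Lambda> * \<Gamma>) $$ (l, j) * Ss ! l $$ (p, q))"
      using \<Lambda> \<Gamma> j by (simp add: scalar_prod_def lessThan_atLeast0)
    also have "\<dots> = (\<Sum>l<?k. if l = j then Ss ! l $$ (p, q) else 0)"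
      using j by (intro sum.cong[OF refl]) (auto simp: \<Lambda>\<Gamma>)
    also have "\<dots> = Ss ! j $$ (p, q)" using j by simp
    finally show "mat_list_comb m n ?c (map (\<lambda>S. S * X) Ss) $$ (p, q) = Ss ! j $$ (p, q)" .
  qed (use S[OF j] in \<open>simp_all add: mat_list_comb_def\<close>)
  finally have comb: "mat_list_comb m n ?c Ss * X = Ss ! j" .
  have "Ss ! j * Y = mat_list_comb m n ?c Ss * (X * Y)"
    unfolding comb[symmetric] by (rule assoc_mult_mat[OF mat_list_comb_carrier X Y])
  also have "\<dots> = mat_list_comb m n ?c Ss"
    unfolding XY by (rule right_mult_one_mat[OF mat_list_comb_carrier])
  finally show ?thesis by blast
qed

text \<open>A span lies in every submodule that contains its generators. Applied to this preimage, that
  transfers invariance under right multiplication by \<open>Y\<close> from the generators to the whole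
  span.\<close>

lemma submodule_vimage_mult_right:
  assumes W: "submodule class_ring W (module_mat TYPE(real) m n)"
    and Y: "Y \<in> carrier_mat n n"
  shows "submodule class_ring {R \<in> carrier_mat m n. R * Y \<in> W} (module_mat TYPE(real) m n)"
proof -
  interpret W: submodule class_ring W "module_mat TYPE(real) m n" by (rule W)
  show ?thesis
  proof (intro submodule.intro, goal_cases)
    case 3
    then show ?case
      using W.m_closed add_mult_distrib_mat[OF _ _ Y] by (auto simp: module_mat_simps)
  next
    case 4
    then show ?case
      using W.zero_closed Y by (auto simp: module_mat_simps)
  next
    case 5
    then show ?case
      using W.smult_closed mult_smult_assoc_mat[OF _ Y] by (auto simp: module_mat_simps)
  qed (auto simp: module_mat_simps W.module)
qed

lemma span_mult_inverse_mem:
  assumes W: "submodule class_ring W (module_mat TYPE(real) m n)" and Ss: "set Ss \<subseteq> W"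
    and R: "R \<in> module.span class_ring (module_mat TYPE(real) m n) (set Ss)"
    and XU: "X \<in> structure_set m n Ss"
    and Y: "Y \<in> carrier_mat n n" and XY: "X * Y = 1\<^sub>m n"
  shows "R \<in> carrier_mat m n" "R * Y \<in> W"
proof -
  interpret vectorspace class_ring "module_mat TYPE(real) m n" by (rule matrix_vs)
  have Wc: "W \<subseteq> carrier_mat m n"
    using submodule.subset[OF W] by (simp add: module_mat_simps)
  have "S * Y \<in> W" if S: "S \<in> set Ss" for S
  proof -
    obtain j where j: "j < length Ss" "S = Ss ! j"
      using S by (metis in_set_conv_nth)
    obtain c where "S * Y = mat_list_comb m n c Ss"
      using structure_set_inverse_comb[OF order.trans[OF Ss Wc] XU Y XY j(1)] j(2) by blast
    then show ?thesis using mat_list_comb_mem_submodule[OF W Ss] by simp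
  qed
  then have "set Ss \<subseteq> {R \<in> carrier_mat m n. R * Y \<in> W}"
    using Ss Wc by auto
  from span_is_subset[OF this submodule_vimage_mult_right[OF W Y]] R
  show "R \<in> carrier_mat m n" "R * Y \<in> W" by auto
qed

section \<open>Lyapunov stability\<close>

lemma hurwitz_transpose:
  assumes M: "M \<in> carrier_mat n n"
  shows "hurwitz M\<^sup>T \<longleftrightarrow> hurwitz M"
proof -
  let ?C = "map_mat complex_of_real M"
  have C: "?C \<in> carrier_mat n n" using M by simp
  have "map_mat complex_of_real M\<^sup>T = ?C\<^sup>T" by (intro eq_matI) simp_all
  moreover have "eigenvalue ?C\<^sup>T z \<longleftrightarrow> eigenvalue ?C z" for z
    using C by (simp add: eigenvalue_root_char_poly[of _ n])
  ultimately show ?thesis using M by (simp add: hurwitz_def)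
qed

text \<open>For an eigenvector \<open>w = a + \<i> b\<close> with eigenvalue \<open>z\<close>, the matrix \<open>M\<close> maps the span of
  \<open>a\<close> and \<open>b\<close> into itself. In the sum of the quadratic forms at \<open>a\<close> and \<open>b\<close> the terms with
  \<open>Im z\<close> cancel by symmetry of \<open>P\<close>, which leaves \<open>Re z * (a \<bullet> P a + b \<bullet> P b)\<close>: a negative
  number equals \<open>Re z\<close> times a positive one.\<close>

lemma lyapunov_hurwitz:
  assumes M: "M \<in> carrier_mat n n" and P: "P \<in> carrier_mat n n" and pd: "pos_definite P"
    and neg: "\<And>v. v \<in> carrier_vec n \<Longrightarrow> v \<noteq> 0\<^sub>v n \<Longrightarrow> v \<bullet> (P *\<^sub>v (M *\<^sub>v v)) < 0"
  shows "hurwitz M"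
  unfolding hurwitz_def
proof (intro conjI allI impI)
  show "square_mat M" using M by simp
  fix z
  assume "eigenvalue (map_mat complex_of_real M) z"
  then obtain w where w: "w \<in> carrier_vec n" "w \<noteq> 0\<^sub>v n"
    and ev: "map_mat complex_of_real M *\<^sub>v w = z \<cdot>\<^sub>v w"
    using M unfolding eigenvalue_def eigenvector_def by auto
  define a where "a = map_vec Re w"
  define b where "b = map_vec Im w"
  have a: "a \<in> carrier_vec n" and b: "b \<in> carrier_vec n"
    using w by (simp_all add: a_def b_def)
  have ev_i: "(\<Sum>j<n. complex_of_real (M $$ (i, j)) * w $ j) = z * w $ i" if "i < n" for i
    using arg_cong[OF ev, of "\<lambda>u. u $ i"] that M w
    by (simp add: scalar_prod_def lessThan_atLeast0)
  have Ma: "M *\<^sub>v a = Re z \<cdot>\<^sub>v a - Im z \<cdot>\<^sub>v b"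
  proof (rule eq_vecI)
    fix i assume "i < dim_vec (Re z \<cdot>\<^sub>v a - Im z \<cdot>\<^sub>v b)"
    then have i: "i < n" using b by simp
    show "(M *\<^sub>v a) $ i = (Re z \<cdot>\<^sub>v a - Im z \<cdot>\<^sub>v b) $ i"
      using arg_cong[OF ev_i[OF i], of Re] i M w
      by (simp add: scalar_prod_def lessThan_atLeast0 a_def b_def)
  qed (use M b in simp)
  have Mb: "M *\<^sub>v b = Re z \<cdot>\<^sub>v b + Im z \<cdot>\<^sub>v a"
  proof (rule eq_vecI)
    fix i assume "i < dim_vec (Re z \<cdot>\<^sub>v b + Im z \<cdot>\<^sub>v a)"
    then have i: "i < n" using a by simp
    show "(M *\<^sub>v b) $ i = (Re z \<cdot>\<^sub>v b + Im z \<cdot>\<^sub>v a) $ i"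
      using arg_cong[OF ev_i[OF i], of Im] i M w
      by (simp add: scalar_prod_def lessThan_atLeast0 a_def b_def)
  qed (use M a in simp)
  have PT: "P\<^sup>T = P"
    and pos: "\<And>v. v \<in> carrier_vec n \<Longrightarrow> v \<noteq> 0\<^sub>v n \<Longrightarrow> v \<bullet> (P *\<^sub>v v) > 0"
    using pd P unfolding pos_definite_def by auto
  have ab: "a \<noteq> 0\<^sub>v n \<or> b \<noteq> 0\<^sub>v n"
  proof (rule ccontr)
    assume "\<not> (a \<noteq> 0\<^sub>v n \<or> b \<noteq> 0\<^sub>v n)"
    then have ab0: "a = 0\<^sub>v n" "b = 0\<^sub>v n" by auto
    have "w $ i = 0" if "i < n" for i
      using arg_cong[OF ab0(1), of "\<lambda>u. u $ i"] arg_cong[OF ab0(2), of "\<lambda>u. u $ i"] that w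
      by (simp add: a_def b_def complex_eq_iff)
    then have "w = 0\<^sub>v n" using w(1) by (intro eq_vecI) auto
    with w(2) show False by simp
  qed
  have Pa: "P *\<^sub>v a \<in> carrier_vec n" and Pb: "P *\<^sub>v b \<in> carrier_vec n"
    by (rule mult_mat_vec_carrier[OF P a], rule mult_mat_vec_carrier[OF P b])
  have sym: "a \<bullet> (P *\<^sub>v b) = b \<bullet> (P *\<^sub>v a)"
    using transpose_vec_mult_scalar[OF P b a] comm_scalar_prod[OF b Pa] by (simp add: PT)
  have "a \<bullet> (P *\<^sub>v (M *\<^sub>v a)) = Re z * (a \<bullet> (P *\<^sub>v a)) - Im z * (a \<bullet> (P *\<^sub>v b))"
    unfolding Ma using a b P Pa Pb
    by (simp add: mult_minus_distrib_mat_vec[OF P] mult_mat_vec[OF P]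
        scalar_prod_minus_distrib[of _ n])
  moreover have "b \<bullet> (P *\<^sub>v (M *\<^sub>v b)) = Re z * (b \<bullet> (P *\<^sub>v b)) + Im z * (b \<bullet> (P *\<^sub>v a))"
    unfolding Mb using a b P Pa Pb
    by (simp add: mult_add_distrib_mat_vec[OF P] mult_mat_vec[OF P]
        scalar_prod_add_distrib[of _ n])
  ultimately have sum: "a \<bullet> (P *\<^sub>v (M *\<^sub>v a)) + b \<bullet> (P *\<^sub>v (M *\<^sub>v b))
      = Re z * (a \<bullet> (P *\<^sub>v a) + b \<bullet> (P *\<^sub>v b))"
    by (simp add: sym algebra_simps)
  \<comment> \<open>One of \<open>a\<close> and \<open>b\<close> may vanish, for instance when \<open>w\<close> is a real eigenvector; that one
    contributes zero, and the other contributes with a strict sign.\<close>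
  have nonstrict: "v \<bullet> (P *\<^sub>v (M *\<^sub>v v)) \<le> 0 \<and> v \<bullet> (P *\<^sub>v v) \<ge> 0" if v: "v \<in> carrier_vec n" for v
  proof (cases "v = 0\<^sub>v n")
    case True
    have "P *\<^sub>v (M *\<^sub>v v) \<in> carrier_vec n" "P *\<^sub>v v \<in> carrier_vec n"
      using mult_mat_vec_carrier[OF P] mult_mat_vec_carrier[OF M] v by blast+
    then show ?thesis by (simp add: True)
  next
    case False
    then show ?thesis using neg[OF v] pos[OF v] by simp
  qed
  note nonstrict[OF a] nonstrict[OF b]
  moreover have "a \<bullet> (P *\<^sub>v (M *\<^sub>v a)) < 0 \<and> a \<bullet> (P *\<^sub>v a) > 0
      \<or> b \<bullet> (P *\<^sub>v (M *\<^sub>v b)) < 0 \<and> b \<bullet> (P *\<^sub>v b) > 0"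
    using ab neg[OF a] neg[OF b] pos[OF a] pos[OF b] by blast
  ultimately have "Re z * (a \<bullet> (P *\<^sub>v a) + b \<bullet> (P *\<^sub>v b)) < 0"
    and "a \<bullet> (P *\<^sub>v a) + b \<bullet> (P *\<^sub>v b) > 0"
    unfolding sum[symmetric] by linarith+
  then show "Re z < 0" by (simp add: mult_less_0_iff)
qed

text \<open>The test vector \<open>(v, M\<^sup>T v)\<close> is chosen to be orthogonal to the range of the block matrix
  containing \<open>X\<close>: that range consists of the vectors \<open>(M x, - x)\<close> with \<open>x\<close> in the range of
  \<open>X\<close>, and \<open>v \<bullet> M x = M\<^sup>T v \<bullet> x\<close>. The form thus reduces to that of the off-diagonal \<open>P\<close>
  blocks, which is \<open>2 * (v \<bullet> P M\<^sup>T v)\<close>.\<close>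

lemma lmi_lyapunov:
  assumes M: "M \<in> carrier_mat n n" and X: "X \<in> carrier_mat n n"
    and P: "P \<in> carrier_mat n n" and PT: "P\<^sup>T = P"
    and lmi: "neg_definite (four_block_mat (0\<^sub>m n n) P P (0\<^sub>m n n)
       + He (four_block_mat (M * X) (M * X) (- X) (- X)))"
    and v: "v \<in> carrier_vec n" "v \<noteq> 0\<^sub>v n"
  shows "v \<bullet> (P *\<^sub>v (M\<^sup>T *\<^sub>v v)) < 0"
proof -
  define u where "u = M\<^sup>T *\<^sub>v v"
  define x where "x = X *\<^sub>v (v + u)"
  let ?F = "four_block_mat (0\<^sub>m n n) P P (0\<^sub>m n n)"
  let ?Z = "four_block_mat (M * X) (M * X) (- X) (- X)"
  let ?z = "v @\<^sub>v u"
  have u: "u \<in> carrier_vec n"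
    unfolding u_def by (rule mult_mat_vec_carrier[OF transpose_carrier_mat[THEN iffD2, OF M] v(1)])
  have x: "x \<in> carrier_vec n"
    unfolding x_def by (rule mult_mat_vec_carrier[OF X add_carrier_vec[OF v(1) u]])
  have z: "?z \<in> carrier_vec (n + n)" using v u by simp
  have MX: "M * X \<in> carrier_mat n n" and nX: "- X \<in> carrier_mat n n" using M X by auto
  have F: "?F \<in> carrier_mat (n + n) (n + n)" using P by simp
  have Z: "?Z \<in> carrier_mat (n + n) (n + n)" using MX nX by simp
  have Pu: "P *\<^sub>v u \<in> carrier_vec n" and Pv: "P *\<^sub>v v \<in> carrier_vec n"
    by (rule mult_mat_vec_carrier[OF P u], rule mult_mat_vec_carrier[OF P v(1)])
  have ZT: "?Z\<^sup>T \<in> carrier_mat (n + n) (n + n)" using Z by (simp only: transpose_carrier_mat)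
  have "?F *\<^sub>v ?z = P *\<^sub>v u @\<^sub>v P *\<^sub>v v"
    using P u v Pu Pv
    by (subst four_block_mat_mult_vec[of _ n n _ n _ n]) auto
  then have "?z \<bullet> (?F *\<^sub>v ?z) = v \<bullet> (P *\<^sub>v u) + u \<bullet> (P *\<^sub>v v)"
    using u v Pu Pv by (simp add: scalar_prod_append[of _ n _ n])
  also have "u \<bullet> (P *\<^sub>v v) = v \<bullet> (P *\<^sub>v u)"
    using transpose_vec_mult_scalar[OF P v(1) u] comm_scalar_prod[OF v(1) Pu] PT by simp
  finally have zF: "?z \<bullet> (?F *\<^sub>v ?z) = 2 * (v \<bullet> (P *\<^sub>v u))" by simp
  have "?Z *\<^sub>v ?z = (M * X *\<^sub>v v + M * X *\<^sub>v u) @\<^sub>v (- X *\<^sub>v v + - X *\<^sub>v u)"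
    using MX nX u v by (subst four_block_mat_mult_vec[of _ n n _ n _ n]) auto
  also have "M * X *\<^sub>v v + M * X *\<^sub>v u = M *\<^sub>v x"
    unfolding x_def mult_add_distrib_mat_vec[OF MX v(1) u, symmetric]
    by (rule assoc_mult_mat_vec[OF M X add_carrier_vec[OF v(1) u]])
  also have "- X *\<^sub>v v + - X *\<^sub>v u = - x"
    unfolding x_def mult_add_distrib_mat_vec[OF nX v(1) u, symmetric]
    using X u v by (intro eq_vecI) auto
  finally have "?z \<bullet> (?Z *\<^sub>v ?z) = v \<bullet> (M *\<^sub>v x) + u \<bullet> (- x)"
    using u v x M by (simp add: scalar_prod_append[of _ n _ n])
  also have "\<dots> = 0"
    using transpose_vec_mult_scalar[OF M x v(1), folded u_def] carrier_vecD[OF u] carrier_vecD[OF x]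
    by simp
  finally have zZ: "?z \<bullet> (?Z *\<^sub>v ?z) = 0" .
  have "?z \<bullet> (?Z\<^sup>T *\<^sub>v ?z) = ?z \<bullet> (?Z *\<^sub>v ?z)"
    using transpose_vec_mult_scalar[OF Z z z]
      comm_scalar_prod[OF z mult_mat_vec_carrier[OF ZT z]] by simp
  with zZ have zZT: "?z \<bullet> (?Z\<^sup>T *\<^sub>v ?z) = 0" by simp
  have "?z \<noteq> 0\<^sub>v (n + n)"
  proof
    assume "?z = 0\<^sub>v (n + n)"
    moreover have "?z $ i = v $ i" if "i < n" for i
      using that u v by simp
    ultimately have "v $ i = 0" if "i < n" for i
      using that by (metis index_zero_vec(1) trans_less_add1)
    then have "v = 0\<^sub>v n" using v(1) by (intro eq_vecI) auto
    with v(2) show False by simp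
  qed
  moreover have "dim_row (?F + He ?Z) = n + n" using X by (simp add: He_def)
  ultimately have "?z \<bullet> ((?F + He ?Z) *\<^sub>v ?z) < 0"
    using lmi z unfolding neg_definite_def by auto
  also have "?z \<bullet> ((?F + He ?Z) *\<^sub>v ?z)
      = ?z \<bullet> (?F *\<^sub>v ?z) + (?z \<bullet> (?Z *\<^sub>v ?z) + ?z \<bullet> (?Z\<^sup>T *\<^sub>v ?z))"
  proof -
    have "(?F + He ?Z) *\<^sub>v ?z = ?F *\<^sub>v ?z + (?Z *\<^sub>v ?z + ?Z\<^sup>T *\<^sub>v ?z)"
      unfolding He_def
      by (simp only: add_mult_distrib_mat_vec[OF F add_carrier_mat[OF ZT] z]
          add_mult_distrib_mat_vec[OF Z ZT z])
    then show ?thesis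
      by (simp only: scalar_prod_add_distrib[OF z mult_mat_vec_carrier[OF F z]
            add_carrier_vec[OF mult_mat_vec_carrier[OF Z z] mult_mat_vec_carrier[OF ZT z]]]
          scalar_prod_add_distrib[OF z mult_mat_vec_carrier[OF Z z] mult_mat_vec_carrier[OF ZT z]])
  qed
  finally show ?thesis unfolding zF zZ zZT by (simp add: u_def)
qed

section \<open>Structured stabilization\<close>

theorem theorem2:
  fixes n m k :: nat
    and A B P R X K :: "real mat"
    and \<S> :: "real mat set"
    and Ss :: "real mat list"
  assumes "A \<in> carrier_mat n n"
    and "B \<in> carrier_mat n m"
    and "VectorSpace.subspace class_ring \<S> (module_mat TYPE(real) m n)"
    and "length Ss = k" and "distinct Ss"
    and "vectorspace.basis class_ring ((module_mat TYPE(real) m n)\<lparr>carrier := \<S>\<rparr>) (set Ss)"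
    and "P \<in> carrier_mat n n" and "pos_definite P"
    and "R \<in> module.span class_ring (module_mat TYPE(real) m n) (set Ss)"
    and "X \<in> carrier_mat n n" and "invertible_mat X" and "X \<in> structure_set m n Ss"
    and "neg_definite
      (four_block_mat (0\<^sub>m n n) P P (0\<^sub>m n n)
       + He (four_block_mat (A * X + B * R) (A * X + B * R) (- X) (- X)))"
    and "K = R * the (mat_inverse X)"
  shows "K \<in> \<S> \<and> hurwitz (A + B * K)"
proof -
  note A = assms(1) and B = assms(2) and P = assms(7) and X = assms(10)
  interpret V: vectorspace class_ring "module_mat TYPE(real) m n" by (rule matrix_vs)
  have W: "submodule class_ring \<S> (module_mat TYPE(real) m n)"
    using assms(3) by (simp add: VectorSpace.subspace_def)
  interpret VS: vectorspace class_ring "(module_mat TYPE(real) m n)\<lparr>carrier := \<S>\<rparr>"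
    using V.subspace_is_vs[OF assms(3)] .
  have Ss: "set Ss \<subseteq> \<S>"
    using assms(6) by (simp add: VS.basis_def)
  obtain Y where inv: "mat_inverse X = Some Y" and Y: "Y \<in> carrier_mat n n"
    and XY: "X * Y = 1\<^sub>m n" and YX: "Y * X = 1\<^sub>m n"
    by (rule mat_inverse_of_invertible[OF X assms(11)])
  have K: "K = R * Y" using assms(14) inv by simp
  have R: "R \<in> carrier_mat m n" and KS: "R * Y \<in> \<S>"
    by (rule span_mult_inverse_mem[OF W Ss assms(9,12) Y XY])+
  have Kc: "K \<in> carrier_mat m n" using R Y K by simp
  let ?M = "A + B * K"
  have M: "?M \<in> carrier_mat n n" using A B Kc by simp
  have "K * X = R"
    using R Y X YX by (simp add: K)
  then have MX: "?M * X = A * X + B * R"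
    using A B Kc X by (simp add: add_mult_distrib_mat[of _ n n])
  have "hurwitz ?M\<^sup>T"
  proof (rule lyapunov_hurwitz[OF _ P assms(8)])
    show "?M\<^sup>T \<in> carrier_mat n n" using M by (simp only: transpose_carrier_mat)
    fix v :: "real vec"
    assume "v \<in> carrier_vec n" "v \<noteq> 0\<^sub>v n"
    then show "v \<bullet> (P *\<^sub>v (?M\<^sup>T *\<^sub>v v)) < 0"
      using lmi_lyapunov[OF M X P] assms(8,13) unfolding MX pos_definite_def by blast
  qed
  then show ?thesis using hurwitz_transpose[OF M] KS K by simp
qed

end
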